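(* Let $G=(V,E,\mathbf w)$ be a weighted undirected graph with $n$ vertices whose Laplacian $L_G$ has eigenvalues $0=\lambda_1=\dots=\lambda_k<\lambda_{k+1}\le\dots\le\lambda_n$ ($G$ has $k$ clusters), let $\epsilon\in(0,1)$, and let $L_{H_i}$, $R_i$ be the iterates of the UGA for graph sparsification described in the context. Let $c_1,c_2>0$ be constants and suppose $\mathrm{Tr}(L_G)/\lambda_{k+1}\le c_2\sqrt{n(n-k)}$. If $i\ge n/\epsilon^2$ and $\|R_{i+1}\|_2^2\le\frac{c_1}{n-k}\|R_{i+1}\|_F^2$, then with $C=\sqrt{c_1}\,c_2$ and provided $C\epsilon<1$, $$(1-C\epsilon)L_G\preceq L_{H_{i+1}}\preceq(1+C\epsilon)L_G,$$ i.e. $(1-O(\epsilon))L_G\preceq L_{H_{i+1}}\preceq(1+O(\epsilon))L_G$.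
   Context: $\mathbf e_u$ are standard basis vectors, $\phi_{(u,v)}=(\mathbf e_u-\mathbf e_v)(\mathbf e_u-\mathbf e_v)^\top$, $L_G=\sum_{(u,v)\in E}w_{(u,v)}\phi_{(u,v)}$ with $w_{(u,v)}>0$; $\langle X,Y\rangle=\mathrm{tr}(X^\top Y)$, $\|\cdot\|_F$ Frobenius norm, $\|\cdot\|_2$ operator norm, $\mathrm{Tr}$ the trace, $X\preceq Y$ means $Y-X$ is positive semidefinite. The UGA for graph sparsification: $R_0=L_G$, $L_{H_0}=0$; for $i=1,2,\dots$: choose $(u_i,v_i)\in E$ maximizing $|\langle\phi_{(u,v)},R_{i-1}\rangle|$ over $(u,v)\in E$; compute $(\alpha_1^i,\alpha_2^i)\in\arg\min_{(\alpha_1,\alpha_2)\in\mathbb R^2}\|L_G-\alpha_1L_{H_{i-1}}-\alpha_2\phi_{(u_i,v_i)}\|_F^2$; set $L_{H_i}=\alpha_1^iL_{H_{i-1}}+\alpha_2^i\phi_{(u_i,v_i)}$ and $R_i=L_G-L_{H_i}$. *)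

theory Defs
  imports "HOL-Analysis.Analysis"
begin

definition outer_prod :: "real^'n \<Rightarrow> real^'n \<Rightarrow> real^'n^'n" where
  "outer_prod x y = (\<chi> i j. x $ i * y $ j)"

definition mat_inner :: "real^'n^'n \<Rightarrow> real^'n^'n \<Rightarrow> real" where
  "mat_inner X Y = trace (transpose X ** Y)"

definition frob_norm :: "real^'n^'n \<Rightarrow> real" where
  "frob_norm X = sqrt (mat_inner X X)"

lemma frob_norm_eq_norm: "frob_norm X = norm X"
proof -
  have "mat_inner X X = X \<bullet> X"
    unfolding mat_inner_def trace_def transpose_def matrix_matrix_mult_def inner_vec_def
    by simp (rule sum.swap)
  then show ?thesis by (simp add: frob_norm_def norm_eq_sqrt_inner)
qed

definition op_norm :: "real^'n^'n \<Rightarrow> real" where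
  "op_norm X = onorm ((*v) X)"

definition psd :: "real^'n^'n \<Rightarrow> bool" where
  "psd X \<longleftrightarrow> transpose X = X \<and> (\<forall>x. 0 \<le> x \<bullet> (X *v x))"

definition loewner_le :: "real^'n^'n \<Rightarrow> real^'n^'n \<Rightarrow> bool"  (infix "\<preceq>" 50) where
  "X \<preceq> Y \<longleftrightarrow> psd (Y - X)"

text \<open>\<open>l 1, \<dots>, l n\<close> are the eigenvalues of \<open>A\<close> in nondecreasing order, each repeated
  according to its multiplicity as a root of the characteristic polynomial.  Values of \<open>l\<close>
  outside \<open>{1..n}\<close> are irrelevant.\<close>

definition sorted_eigenvalues :: "real^'n^'n \<Rightarrow> (nat \<Rightarrow> real) \<Rightarrow> bool" where
  "sorted_eigenvalues A l \<longleftrightarrow>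
     mono_on {1..CARD('n)} l \<and>
     (\<forall>x. det (mat x - A) = (\<Prod>j=1..CARD('n). x - l j))"

text \<open>The vertex set is the finite type \<open>'n\<close>.  An undirected edge is represented by one of its
  two orientations, chosen arbitrarily; the second conjunct ensures that every edge is listed
  only once.  The choice is immaterial, see \<open>edge_mat_swap\<close> below.\<close>

definition weighted_graph :: "('n \<times> 'n) set \<Rightarrow> ('n \<times> 'n \<Rightarrow> real) \<Rightarrow> bool" where
  "weighted_graph E w \<longleftrightarrow>
     (\<forall>(u, v)\<in>E. u \<noteq> v \<and> (v, u) \<notin> E \<and> 0 < w (u, v))"

definition edge_mat :: "'n \<times> 'n \<Rightarrow> real^'n^'n"  ("\<phi>") where
  "\<phi> = (\<lambda>(u, v). outer_prod (axis u 1 - axis v 1) (axis u 1 - axis v 1))"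

lemma edge_mat_swap: "\<phi> (u, v) = \<phi> (v, u)"
  by (simp add: edge_mat_def outer_prod_def vec_eq_iff algebra_simps)

definition laplacian :: "('n::finite \<times> 'n) set \<Rightarrow> ('n \<times> 'n \<Rightarrow> real) \<Rightarrow> real^'n^'n" where
  "laplacian E w = (\<Sum>e\<in>E. w e *\<^sub>R \<phi> e)"

text \<open>\<open>uga_run E w LH R\<close> says that \<open>LH\<close> and \<open>R\<close> are the sequences of iterates and residuals
  of some run of the algorithm.  Ties in the edge selection, and non-unique minimisers in the
  least-squares step, may be resolved arbitrarily.  Step \<open>i \<ge> 1\<close> appears here as \<open>Suc i\<close>.\<close>

definition uga_run ::
  "('n::finite \<times> 'n) set \<Rightarrow> ('n \<times> 'n \<Rightarrow> real) \<Rightarrow>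
   (nat \<Rightarrow> real^'n^'n) \<Rightarrow> (nat \<Rightarrow> real^'n^'n) \<Rightarrow> bool" where
  "uga_run E w LH R \<longleftrightarrow>
     LH 0 = 0 \<and>
     (\<forall>i. R i = laplacian E w - LH i) \<and>
     (\<forall>i. \<exists>e \<alpha>\<^sub>1 \<alpha>\<^sub>2.
        is_arg_max (\<lambda>e'. \<bar>mat_inner (\<phi> e') (R i)\<bar>) (\<lambda>e'. e' \<in> E) e \<and>
        is_arg_min (\<lambda>(a\<^sub>1, a\<^sub>2). (frob_norm (laplacian E w - a\<^sub>1 *\<^sub>R LH i - a\<^sub>2 *\<^sub>R \<phi> e))\<^sup>2)
          (\<lambda>_. True) (\<alpha>\<^sub>1, \<alpha>\<^sub>2) \<and>
        LH (Suc i) = \<alpha>\<^sub>1 *\<^sub>R LH i + \<alpha>\<^sub>2 *\<^sub>R \<phi> e)"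

end

theory Submission imports Defs begin

text \<open>Let \<open>r\<^sub>i\<close> be the squared Frobenius norm of the residual \<open>R\<^sub>i\<close> and \<open>T = Tr L\<close>.
  Optimality of the least-squares step makes \<open>R\<^sub>i\<close> orthogonal to \<open>L\<^bsub>H\<^sub>i\<^esub>\<close>, so
  \<open>r\<^sub>i = \<langle>R\<^sub>i, L\<rangle>\<close> is at most \<open>T / 2\<close> times the largest correlation of \<open>R\<^sub>i\<close> with an edge matrix.
  Edge matrices have norm 2, hence \<open>r\<^sub>i\<^sub>+\<^sub>1 \<le> r\<^sub>i - r\<^sub>i\<^sup>2 / T\<^sup>2\<close> and \<open>r\<^sub>i \<le> T\<^sup>2 / (i + 1)\<close>.
  With the assumptions this bounds the operator norm of \<open>R\<^sub>i\<^sub>+\<^sub>1\<close> by \<open>C \<epsilon> \<lambda>\<^sub>k\<^sub>+\<^sub>1\<close>.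
  Since \<open>R\<^sub>i\<^sub>+\<^sub>1\<close> vanishes on the kernel of \<open>L\<close>, and the Rayleigh quotient of \<open>L\<close> is at least
  \<open>\<lambda>\<^sub>k\<^sub>+\<^sub>1\<close> on the orthogonal complement of that kernel, the quadratic form of \<open>R\<^sub>i\<^sub>+\<^sub>1\<close> is bounded
  by \<open>C \<epsilon>\<close> times that of \<open>L\<close>.\<close>

section \<open>Least-squares geometry and a scalar recurrence\<close>

lemma quadratic_nonneg_imp_linear_zero:
  fixes b c :: real
  assumes "\<And>t. 0 \<le> t * b + t\<^sup>2 * c"
  shows "b = 0"
proof (rule ccontr)
  assume b: "b \<noteq> 0"
  \<comment> \<open>Near 0 the linear term dominates. A positive \<open>d\<close> above
    \<open>c\<close> makes the test point \<open>t = - b / d\<close> give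
    \<open>(b / d)^2 * (c - d)\<close>, which is negative.\<close>
  define d where "d = \<bar>c\<bar> + 1"
  have d: "d > 0" "c < d" by (auto simp: d_def)
  have "0 \<le> (- b / d) * b + (- b / d)\<^sup>2 * c" by (rule assms)
  also have "\<dots> = (b\<^sup>2 / d\<^sup>2) * (c - d)"
    using d by (simp add: power2_eq_square field_simps)
  also have "\<dots> < 0"
    using b d by (intro mult_pos_neg) auto
  finally show False by simp
qed

lemma minimal_norm_orthogonal:
  fixes r v :: "'a::real_inner"
  assumes "\<And>t. (norm r)\<^sup>2 \<le> (norm (r - t *\<^sub>R v))\<^sup>2"
  shows "r \<bullet> v = 0"
proof -
  have "- 2 * (r \<bullet> v) = 0"
  proof (rule quadratic_nonneg_imp_linear_zero)
    fix t
    have "(norm (r - t *\<^sub>R v))\<^sup>2 = (norm r)\<^sup>2 + t * (- 2 * (r \<bullet> v)) + t\<^sup>2 * (v \<bullet> v)"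
      unfolding power2_norm_eq_inner
      by (simp add: inner_diff inner_commute power2_eq_square algebra_simps)
    then show "0 \<le> t * (- 2 * (r \<bullet> v)) + t\<^sup>2 * (v \<bullet> v)"
      using assms[of t] by linarith
  qed
  then show ?thesis by simp
qed

text \<open>Rescaling the optimal fit by \<open>1 + t\<close> stays within the admissible
  combinations of \<open>H\<close> and \<open>g\<close>. The first variation along the fit itself
  therefore vanishes.\<close>

lemma least_squares_orthogonal:
  fixes L H g :: "'a::real_inner"
  assumes "\<And>a b. (norm (L - \<alpha> *\<^sub>R H - \<beta> *\<^sub>R g))\<^sup>2 \<le> (norm (L - a *\<^sub>R H - b *\<^sub>R g))\<^sup>2"
  shows "(L - \<alpha> *\<^sub>R H - \<beta> *\<^sub>R g) \<bullet> (\<alpha> *\<^sub>R H + \<beta> *\<^sub>R g) = 0"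
proof (rule minimal_norm_orthogonal)
  fix t
  have "L - \<alpha> *\<^sub>R H - \<beta> *\<^sub>R g - t *\<^sub>R (\<alpha> *\<^sub>R H + \<beta> *\<^sub>R g)
      = L - (\<alpha> + t * \<alpha>) *\<^sub>R H - (\<beta> + t * \<beta>) *\<^sub>R g"
    by (simp add: algebra_simps)
  then show "(norm (L - \<alpha> *\<^sub>R H - \<beta> *\<^sub>R g))\<^sup>2
      \<le> (norm (L - \<alpha> *\<^sub>R H - \<beta> *\<^sub>R g - t *\<^sub>R (\<alpha> *\<^sub>R H + \<beta> *\<^sub>R g)))\<^sup>2"
    using assms by metis
qed

text \<open>The optimum is compared with one competitor: keep \<open>H\<close> with coefficient 1
  and add the orthogonal projection of \<open>L - H\<close> onto \<open>g\<close>. The gain is the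
  squared length of that projection.\<close>

lemma least_squares_decrease:
  fixes L H g :: "'a::real_inner"
  assumes "\<And>a b. (norm (L - \<alpha> *\<^sub>R H - \<beta> *\<^sub>R g))\<^sup>2 \<le> (norm (L - a *\<^sub>R H - b *\<^sub>R g))\<^sup>2"
    and "g \<noteq> 0"
  shows "(norm (L - \<alpha> *\<^sub>R H - \<beta> *\<^sub>R g))\<^sup>2 \<le> (norm (L - H))\<^sup>2 - ((L - H) \<bullet> g)\<^sup>2 / (norm g)\<^sup>2"
proof -
  define r where "r = L - H"
  define t where "t = (r \<bullet> g) / (g \<bullet> g)"
  have g: "g \<bullet> g \<noteq> 0" using assms(2) by simp
  have "(norm (L - \<alpha> *\<^sub>R H - \<beta> *\<^sub>R g))\<^sup>2 \<le> (norm (r - t *\<^sub>R g))\<^sup>2"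
    using assms(1)[of 1 t] by (simp add: r_def)
  also have "\<dots> = r \<bullet> r - 2 * t * (r \<bullet> g) + t * (t * (g \<bullet> g))"
    by (simp add: power2_norm_eq_inner inner_diff inner_commute algebra_simps)
  also have "t * (g \<bullet> g) = r \<bullet> g"
    using g by (simp add: t_def)
  also have "r \<bullet> r - 2 * t * (r \<bullet> g) + t * (r \<bullet> g) = r \<bullet> r - (r \<bullet> g)\<^sup>2 / (g \<bullet> g)"
    by (simp add: t_def power2_eq_square)
  finally show ?thesis
    by (simp add: r_def power2_norm_eq_inner)
qed

text \<open>While \<open>r i\<close> is positive, \<open>1 / r i\<close> grows by at least
  \<open>1 / B\<close> per step. The proof uses products instead of reciprocals, so that
  \<open>r i = 0\<close> is covered as well.\<close>

lemma quadratic_recurrence_bound: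
  fixes r :: "nat \<Rightarrow> real"
  assumes B: "0 < B" and nonneg: "\<And>i. 0 \<le> r i" and init: "r 0 \<le> B"
    and step: "\<And>i. r (Suc i) \<le> r i - (r i)\<^sup>2 / B"
  shows "r i \<le> B / (real i + 1)"
proof (induction i)
  case 0
  then show ?case using init by simp
next
  case (Suc i)
  define x m where "x = r i" and "m = real i"
  have x: "0 \<le> x" "x * (m + 1) \<le> B" and m: "0 \<le> m"
    using Suc nonneg by (simp_all add: x_def m_def field_simps)
  have "x * 1 \<le> x * (m + 1)" using x(1) m by (intro mult_left_mono) auto
  \<comment> \<open>The right-hand side expands to \<open>B * B - x * (B - x) * (m + 2)\<close>.
    Substituting the bound on \<open>x\<close> directly would fail, since \<open>x - x^2 / B\<close>
    is not monotone on the whole of \<open>[0, B]\<close>.\<close>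
  then have "0 \<le> (B - x * (m + 1)) * (B - x) + x * x" using x by simp
  then have "x * (B - x) * (m + 2) \<le> B * B" by (simp add: algebra_simps)
  moreover have "r (Suc i) * B \<le> x * (B - x)"
    using step[of i] B by (simp add: x_def field_simps power2_eq_square)
  then have "r (Suc i) * B * (m + 2) \<le> x * (B - x) * (m + 2)"
    using m by (intro mult_right_mono) auto
  ultimately have "(r (Suc i) * (m + 2)) * B \<le> B * B" by (simp add: algebra_simps)
  then have "r (Suc i) * (m + 2) \<le> B" using B by (simp only: mult_le_cancel_right_pos)
  then show ?case by (simp add: m_def field_simps)
qed

section \<open>Symmetric matrices and minimal Rayleigh quotients\<close>

lemma symmetric_matrix_inner:
  fixes A :: "real^'n^'n"
  assumes "transpose A = A"
  shows "x \<bullet> (A *v y) = (A *v x) \<bullet> y"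
  using dot_lmul_matrix[of x A y] assms by (metis transpose_matrix_vector)

lemma scalar_mat_mult_vec: "mat m *v x = m *\<^sub>R (x :: real^'n)"
  by (simp add: vec_eq_iff matrix_vector_mult_def mat_def if_distrib if_distribR cong: if_cong)

text \<open>Links eigenvectors to \<open>sorted_eigenvalues\<close>, which describes the spectrum
  only through the characteristic polynomial.\<close>

lemma eigenvector_imp_det_zero:
  fixes A :: "real^'n^'n"
  assumes "A *v x = m *\<^sub>R x" "x \<noteq> 0"
  shows "det (mat m - A) = 0"
proof -
  have "(mat m - A) *v x = 0"
    using assms(1)
    by (simp add: matrix_vector_mult_diff_rdistrib scaleR_matrix_vector_assoc[symmetric]
        scalar_mat_mult_vec)
  then show ?thesis
    using assms(2) by (metis invertible_det_nz matrix_left_invertible_ker invertible_left_inverse)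
qed

text \<open>The quadratic form attains its minimum on the compact unit sphere of \<open>W\<close>;
  homogeneity extends the bound to all of \<open>W\<close>, and a first variation shows that the
  minimiser is an eigenvector.\<close>

lemma Rayleigh_quotient_attained:
  fixes A :: "real^'n^'n"
  assumes sym: "transpose A = A" and W: "subspace W"
    and inv: "\<And>x. x \<in> W \<Longrightarrow> A *v x \<in> W" and "z \<in> W" "z \<noteq> 0"
  obtains m x where "x \<in> W" "x \<noteq> 0" "A *v x = m *\<^sub>R x"
    "\<And>y. y \<in> W \<Longrightarrow> m * (y \<bullet> y) \<le> y \<bullet> (A *v y)"
proof -
  define S where "S = W \<inter> sphere 0 1"
  have "compact S"
    unfolding S_def using closed_subspace[OF W] by (intro closed_Int_compact) auto
  moreover have unit: "(1 / norm y) *\<^sub>R y \<in> S" if "y \<in> W" "y \<noteq> 0" for y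
    using that W by (simp add: S_def subspace_scale)
  then have "S \<noteq> {}" using assms(4,5) by blast
  moreover have "continuous_on S (\<lambda>y. y \<bullet> (A *v y))"
    by (intro continuous_intros matrix_vector_mult_linear_continuous_on)
  ultimately obtain x where x: "x \<in> S" and min: "\<And>y. y \<in> S \<Longrightarrow> x \<bullet> (A *v x) \<le> y \<bullet> (A *v y)"
    using continuous_attains_inf[of S "\<lambda>y. y \<bullet> (A *v y)"] by auto
  define m where "m = x \<bullet> (A *v x)"
  have xW: "x \<in> W" and nx: "x \<bullet> x = 1"
    using x by (auto simp: S_def norm_eq_1)
  have low: "m * (y \<bullet> y) \<le> y \<bullet> (A *v y)" if "y \<in> W" for y
  proof (cases "y = 0")
    case False
    have "m \<le> ((1 / norm y) *\<^sub>R y) \<bullet> (A *v ((1 / norm y) *\<^sub>R y))"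
      using min[OF unit[OF that False]] by (simp only: m_def)
    also have "\<dots> = (y \<bullet> (A *v y)) / (y \<bullet> y)"
      by (simp add: matrix_vector_mult_scaleR dot_square_norm power2_eq_square)
    finally show ?thesis using False by (simp add: field_simps)
  qed simp
  \<comment> \<open>The perturbation direction is the eigenvector defect itself. Invariance puts it
    in \<open>W\<close>, and along \<open>x + t g\<close> the linear coefficient is
    \<open>2 * (g \<bullet> g)\<close>.\<close>
  define g where "g = A *v x - m *\<^sub>R x"
  have gW: "g \<in> W" unfolding g_def using W inv xW by (intro subspace_diff subspace_scale)
  have "2 * (g \<bullet> g) = 0"
  proof (rule quadratic_nonneg_imp_linear_zero)
    fix t
    have "x + t *\<^sub>R g \<in> W" using W xW gW by (intro subspace_add subspace_scale)
    from low[OF this]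
    have "0 \<le> (x + t *\<^sub>R g) \<bullet> (A *v (x + t *\<^sub>R g)) - m * ((x + t *\<^sub>R g) \<bullet> (x + t *\<^sub>R g))"
      by simp
    also have "\<dots> = (x \<bullet> (A *v x) - m * (x \<bullet> x)) + t * (x \<bullet> (A *v g) + g \<bullet> (A *v x) - 2 * m * (x \<bullet> g))
        + t\<^sup>2 * (g \<bullet> (A *v g) - m * (g \<bullet> g))"
      by (simp add: matrix_vector_right_distrib matrix_vector_mult_scaleR inner_add inner_commute
          power2_eq_square algebra_simps)
    also have "x \<bullet> (A *v x) - m * (x \<bullet> x) = 0" by (simp add: m_def nx)
    also have "x \<bullet> (A *v g) + g \<bullet> (A *v x) - 2 * m * (x \<bullet> g) = 2 * ((A *v x - m *\<^sub>R x) \<bullet> g)"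
      by (simp add: symmetric_matrix_inner[OF sym, of x g] inner_diff inner_commute algebra_simps)
    finally show "0 \<le> t * (2 * (g \<bullet> g)) + t\<^sup>2 * (g \<bullet> (A *v g) - m * (g \<bullet> g))"
      by (simp add: g_def)
  qed
  then have "A *v x = m *\<^sub>R x" by (simp add: g_def)
  moreover have "x \<noteq> 0" using nx by auto
  ultimately show thesis using that xW low by blast
qed

section \<open>Edge matrices and the Laplacian as a quadratic form\<close>

lemma mat_inner_eq_inner: "mat_inner X Y = X \<bullet> Y"
  unfolding mat_inner_def trace_def transpose_def matrix_matrix_mult_def inner_vec_def
  by simp (rule sum.swap)

lemma outer_prod_mult_vec: "outer_prod x y *v z = (y \<bullet> z) *\<^sub>R x"
  by (simp add: outer_prod_def matrix_vector_mult_def vec_eq_iff inner_vec_def sum_distrib_left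
      mult_ac)

lemma trace_outer_prod: "trace (outer_prod x y) = x \<bullet> y"
  by (simp add: trace_def outer_prod_def inner_vec_def)

lemma norm_outer_prod: "norm (outer_prod x y) = norm x * norm y"
proof -
  have "outer_prod x y \<bullet> outer_prod x y = (x \<bullet> x) * (y \<bullet> y)"
    by (simp add: outer_prod_def inner_vec_def sum_product mult_ac)
  then show ?thesis
    by (simp add: norm_eq_sqrt_inner real_sqrt_mult)
qed

lemma inner_edge_vector:
  fixes u v :: "'n::finite"
  assumes "u \<noteq> v"
  shows "(axis u 1 - axis v 1) \<bullet> (axis u 1 - axis v 1 :: real^'n) = 2"
  using assms by (simp add: inner_diff inner_axis_axis)

lemma norm_edge_mat:
  assumes "u \<noteq> v"
  shows "norm (\<phi> (u, v)) = 2"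
  using inner_edge_vector[OF assms]
  by (simp add: edge_mat_def norm_outer_prod flip: power2_eq_square power2_norm_eq_inner)

lemma trace_edge_mat:
  assumes "u \<noteq> v"
  shows "trace (\<phi> (u, v)) = 2"
  using inner_edge_vector[OF assms] by (simp add: edge_mat_def trace_outer_prod)

lemma edge_mat_mult_vec: "\<phi> (u, v) *v x = (x $ u - x $ v) *\<^sub>R (axis u 1 - axis v 1)"
  by (simp add: edge_mat_def outer_prod_mult_vec inner_diff_left inner_axis')

lemma edge_mat_quadratic_form: "x \<bullet> (\<phi> (u, v) *v x) = (x $ u - x $ v)\<^sup>2"
  by (simp add: edge_mat_mult_vec inner_diff_right inner_axis power2_eq_square)

lemma transpose_edge_mat: "transpose (\<phi> e) = \<phi> e"
  by (simp add: edge_mat_def outer_prod_def transpose_def vec_eq_iff split: prod.split)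

lemma transpose_add: "transpose (A + B) = transpose A + transpose (B :: 'a::plus^'n^'m)"
  by (simp add: transpose_def vec_eq_iff)

lemma transpose_diff: "transpose (A - B) = transpose A - transpose (B :: 'a::minus^'n^'m)"
  by (simp add: transpose_def vec_eq_iff)

lemma transpose_laplacian: "transpose (laplacian E w) = laplacian E w"
proof -
  have "\<phi> e $ i $ j = \<phi> e $ j $ i" for e :: "'a \<times> 'a" and i j
    by (simp add: edge_mat_def outer_prod_def split: prod.split)
  then show ?thesis
    by (simp add: laplacian_def transpose_def vec_eq_iff)
qed

lemma matrix_sum_mult_vec:
  fixes f :: "'a \<Rightarrow> real^'n^'m"
  shows "(\<Sum>a\<in>A. f a) *v x = (\<Sum>a\<in>A. f a *v x)"
  by (induction A rule: infinite_finite_induct) (auto simp: matrix_vector_mult_add_rdistrib)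

lemma laplacian_mult_vec: "laplacian E w *v x = (\<Sum>e\<in>E. w e *\<^sub>R (\<phi> e *v x))"
  by (simp add: laplacian_def matrix_sum_mult_vec scaleR_matrix_vector_assoc)

lemma laplacian_quadratic_form:
  "x \<bullet> (laplacian E w *v x) = (\<Sum>e\<in>E. w e * (x $ fst e - x $ snd e)\<^sup>2)"
proof -
  have "x \<bullet> (\<phi> e *v x) = (x $ fst e - x $ snd e)\<^sup>2" for e
    by (cases e) (simp add: edge_mat_quadratic_form)
  then show ?thesis
    by (simp add: laplacian_mult_vec inner_sum_right)
qed

section \<open>Kernel, trace and spectral gap of a graph Laplacian\<close>

context
  fixes E :: "('n::finite \<times> 'n) set" and w :: "'n \<times> 'n \<Rightarrow> real"
  assumes graph: "weighted_graph E w"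
begin

lemma weight_pos: "e \<in> E \<Longrightarrow> 0 < w e"
  using graph by (auto simp: weighted_graph_def)

lemma norm_edge_mat_graph: "e \<in> E \<Longrightarrow> norm (\<phi> e) = 2"
  using graph by (cases e) (auto simp: weighted_graph_def norm_edge_mat)

lemma trace_laplacian: "trace (laplacian E w) = 2 * (\<Sum>e\<in>E. w e)"
proof -
  have "trace (\<phi> e) = 2" if "e \<in> E" for e
    using that graph by (cases e) (auto simp: weighted_graph_def trace_edge_mat)
  moreover have "trace (laplacian E w) = (\<Sum>e\<in>E. w e * trace (\<phi> e))"
    by (simp add: laplacian_def trace_def sum_distrib_left) (rule sum.swap)
  ultimately show ?thesis
    by (simp add: sum_distrib_right mult.commute)
qed

text \<open>The quadratic form is a sum of squared differences with positive weights, so its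
  vanishing forces \<open>x\<close> to agree at the two ends of every edge.\<close>

lemma laplacian_kernel_edge:
  assumes "laplacian E w *v x = 0" "e \<in> E"
  shows "\<phi> e *v x = 0"
proof -
  have "(\<Sum>e\<in>E. w e * (x $ fst e - x $ snd e)\<^sup>2) = 0"
    using assms(1) laplacian_quadratic_form[of x E w] by simp
  then have "w e * (x $ fst e - x $ snd e)\<^sup>2 = 0"
    using assms(2) weight_pos
    by (subst (asm) sum_nonneg_eq_0_iff) (auto simp: less_imp_le)
  then have "x $ fst e = x $ snd e" using weight_pos[OF assms(2)] by simp
  then show ?thesis by (cases e) (simp add: edge_mat_mult_vec)
qed

text \<open>Each edge matrix has norm and trace both equal to 2. The estimate supplies the starting
  value of the residual recurrence.\<close>

lemma norm_laplacian_le_trace: "norm (laplacian E w) \<le> trace (laplacian E w)"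
proof -
  have "norm (laplacian E w) \<le> (\<Sum>e\<in>E. norm (w e *\<^sub>R \<phi> e))"
    unfolding laplacian_def by (rule norm_sum)
  also have "\<dots> = (\<Sum>e\<in>E. 2 * w e)"
    using weight_pos norm_edge_mat_graph by (intro sum.cong) (auto simp: less_imp_le)
  finally show ?thesis by (simp add: trace_laplacian sum_distrib_left)
qed

lemma laplacian_spectral_gap:
  assumes eig: "sorted_eigenvalues (laplacian E w) lam"
    and zero: "\<forall>j\<in>{1..k}. lam j = 0" and k: "k < CARD('n)"
    and z: "\<And>y. laplacian E w *v y = 0 \<Longrightarrow> orthogonal z y"
  shows "lam (k + 1) * (z \<bullet> z) \<le> z \<bullet> (laplacian E w *v z)"
proof (cases "z = 0")
  case False
  let ?L = "laplacian E w"
  define W where "W = {z. \<forall>y. ?L *v y = 0 \<longrightarrow> z \<bullet> y = 0}"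
  have "subspace W"
    by (auto simp: W_def subspace_def inner_add_left)
  \<comment> \<open>By symmetry the matrix can be moved onto the kernel vector, so its whole range
    is orthogonal to its kernel.\<close>
  moreover have "?L *v x \<in> W" for x
    by (auto simp: W_def simp flip: symmetric_matrix_inner[OF transpose_laplacian])
  moreover have zW: "z \<in> W" using z by (simp add: W_def orthogonal_def)
  ultimately obtain m x where x: "x \<in> W" "x \<noteq> 0" "?L *v x = m *\<^sub>R x"
    and low: "\<And>y. y \<in> W \<Longrightarrow> m * (y \<bullet> y) \<le> y \<bullet> (?L *v y)"
    using Rayleigh_quotient_attained[OF transpose_laplacian] False by metis
  \<comment> \<open>An eigenvector for 0 would lie both in the kernel and in its complement
    \<open>W\<close>. As a nonzero root, \<open>m\<close> must then be some \<open>lam j\<close>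
    with \<open>j > k\<close>.\<close>
  have "m \<noteq> 0"
  proof
    assume "m = 0"
    with x have "x \<bullet> x = 0" by (simp add: W_def)
    with x show False by simp
  qed
  have "(\<Prod>j=1..CARD('n). m - lam j) = 0"
    using eig eigenvector_imp_det_zero[OF x(3,2)] by (simp add: sorted_eigenvalues_def)
  then obtain j where j: "j \<in> {1..CARD('n)}" "m = lam j" by auto
  with zero \<open>m \<noteq> 0\<close> have "k + 1 \<le> j" by (metis atLeastAtMost_iff not_less_eq_eq Suc_eq_plus1)
  then have "lam (k + 1) \<le> m"
    using eig j k by (auto simp: sorted_eigenvalues_def intro!: mono_onD[of _ lam])
  then have "lam (k + 1) * (z \<bullet> z) \<le> m * (z \<bullet> z)" by (intro mult_right_mono) auto
  then show ?thesis using low[OF zW] by linarith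
qed simp

section \<open>Iterates and residuals of a run of the algorithm\<close>

context
  fixes LH R :: "nat \<Rightarrow> real^'n^'n"
  assumes run: "uga_run E w LH R"
begin

lemma uga_residual: "R i = laplacian E w - LH i"
  using run by (simp add: uga_run_def)

lemma uga_step:
  obtains e \<alpha> \<beta> where "e \<in> E" "\<And>e'. e' \<in> E \<Longrightarrow> \<bar>\<phi> e' \<bullet> R i\<bar> \<le> \<bar>\<phi> e \<bullet> R i\<bar>"
    "\<And>a b. (norm (laplacian E w - \<alpha> *\<^sub>R LH i - \<beta> *\<^sub>R \<phi> e))\<^sup>2
         \<le> (norm (laplacian E w - a *\<^sub>R LH i - b *\<^sub>R \<phi> e))\<^sup>2"
    "LH (Suc i) = \<alpha> *\<^sub>R LH i + \<beta> *\<^sub>R \<phi> e"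
proof -
  have "\<exists>e \<alpha> \<beta>. is_arg_max (\<lambda>e'. \<bar>mat_inner (\<phi> e') (R i)\<bar>) (\<lambda>e'. e' \<in> E) e \<and>
        is_arg_min (\<lambda>(a, b). (frob_norm (laplacian E w - a *\<^sub>R LH i - b *\<^sub>R \<phi> e))\<^sup>2)
          (\<lambda>_. True) (\<alpha>, \<beta>) \<and> LH (Suc i) = \<alpha> *\<^sub>R LH i + \<beta> *\<^sub>R \<phi> e"
    using run unfolding uga_run_def by blast
  then show thesis
    unfolding is_arg_max_linorder is_arg_min_linorder mat_inner_eq_inner frob_norm_eq_norm
    by (elim exE conjE) (rule that, auto)
qed

lemma uga_residual_orthogonal: "R i \<bullet> LH i = 0"
proof (cases i)
  case 0
  then show ?thesis using run by (simp add: uga_run_def)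
next
  case (Suc j)
  obtain e \<alpha> \<beta> where
    "\<And>a b. (norm (laplacian E w - \<alpha> *\<^sub>R LH j - \<beta> *\<^sub>R \<phi> e))\<^sup>2
         \<le> (norm (laplacian E w - a *\<^sub>R LH j - b *\<^sub>R \<phi> e))\<^sup>2"
    "LH (Suc j) = \<alpha> *\<^sub>R LH j + \<beta> *\<^sub>R \<phi> e"
    using uga_step[of j] by metis
  from least_squares_orthogonal[OF this(1)] this(2) show ?thesis
    by (simp add: Suc uga_residual diff_diff_eq)
qed

text \<open>A run selects an edge in its first step, so the edge set is nonempty.\<close>

lemma uga_trace_pos: "0 < trace (laplacian E w)"
proof -
  obtain e where "e \<in> E" using uga_step[of 0] by metis
  then show ?thesis
    unfolding trace_laplacian using weight_pos by (intro mult_pos_pos sum_pos) auto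
qed

lemma uga_residual_step:
  "(norm (R (Suc i)))\<^sup>2 \<le> (norm (R i))\<^sup>2 - ((norm (R i))\<^sup>2)\<^sup>2 / (trace (laplacian E w))\<^sup>2"
proof -
  let ?T = "trace (laplacian E w)"
  obtain e \<alpha> \<beta> where e: "e \<in> E" and max: "\<And>e'. e' \<in> E \<Longrightarrow> \<bar>\<phi> e' \<bullet> R i\<bar> \<le> \<bar>\<phi> e \<bullet> R i\<bar>"
    and opt: "\<And>a b. (norm (laplacian E w - \<alpha> *\<^sub>R LH i - \<beta> *\<^sub>R \<phi> e))\<^sup>2
         \<le> (norm (laplacian E w - a *\<^sub>R LH i - b *\<^sub>R \<phi> e))\<^sup>2"
    and LH: "LH (Suc i) = \<alpha> *\<^sub>R LH i + \<beta> *\<^sub>R \<phi> e"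
    using uga_step[of i] by metis
  define m where "m = \<bar>\<phi> e \<bullet> R i\<bar>"
  have "(norm (R i))\<^sup>2 = laplacian E w \<bullet> R i"
    using uga_residual_orthogonal[of i] uga_residual[of i]
    by (simp add: power2_norm_eq_inner inner_diff inner_commute)
  also have "\<dots> = (\<Sum>e'\<in>E. w e' * (\<phi> e' \<bullet> R i))"
    by (simp add: laplacian_def inner_sum_left)
  also have "\<dots> \<le> (\<Sum>e'\<in>E. w e' * m)"
    using max weight_pos unfolding m_def
    by (intro sum_mono mult_left_mono) (auto simp: less_imp_le intro: order_trans[OF abs_ge_self])
  also have "\<dots> = ?T / 2 * m"
    by (simp add: trace_laplacian sum_distrib_right)
  finally have "((norm (R i))\<^sup>2)\<^sup>2 \<le> (?T / 2 * m)\<^sup>2"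
    by (intro power_mono) auto
  \<comment> \<open>The weights sum to \<open>?T / 2\<close>. The resulting factor 4 matches the
    squared norm of an edge matrix in the guaranteed decrease.\<close>
  then have "((norm (R i))\<^sup>2)\<^sup>2 / ?T\<^sup>2 \<le> m\<^sup>2 / 4"
    using uga_trace_pos by (simp add: field_simps power_mult_distrib)
  moreover have "(norm (R (Suc i)))\<^sup>2 \<le> (norm (R i))\<^sup>2 - m\<^sup>2 / 4"
    using least_squares_decrease[OF opt] norm_edge_mat_graph[OF e]
    by (fastforce simp: uga_residual LH diff_diff_eq m_def inner_commute)
  ultimately show ?thesis by linarith
qed

lemma uga_residual_bound: "(norm (R i))\<^sup>2 \<le> (trace (laplacian E w))\<^sup>2 / (real i + 1)"
proof (rule quadratic_recurrence_bound[where r = "\<lambda>i. (norm (R i))\<^sup>2"])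
  show "(norm (R 0))\<^sup>2 \<le> (trace (laplacian E w))\<^sup>2"
    using norm_laplacian_le_trace run by (intro power_mono) (auto simp: uga_run_def)
qed (use uga_residual_step uga_trace_pos in auto)

lemma transpose_uga: "transpose (LH i) = LH i"
proof (induction i)
  case 0
  then show ?case using run by (simp add: uga_run_def transpose_def vec_eq_iff)
next
  case (Suc i)
  obtain e \<alpha> \<beta> where "LH (Suc i) = \<alpha> *\<^sub>R LH i + \<beta> *\<^sub>R \<phi> e"
    using uga_step[of i] by metis
  then show ?case
    by (simp add: Suc transpose_add transpose_scalar transpose_edge_mat)
qed

text \<open>Every iterate is built from selected edges, and each of those annihilates the kernel of
  the Laplacian.\<close>

lemma uga_kernel:
  assumes "laplacian E w *v x = 0"
  shows "LH i *v x = 0"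
proof (induction i)
  case 0
  then show ?case using run by (simp add: uga_run_def)
next
  case (Suc i)
  obtain e \<alpha> \<beta> where "e \<in> E" "LH (Suc i) = \<alpha> *\<^sub>R LH i + \<beta> *\<^sub>R \<phi> e"
    using uga_step[of i] by metis
  then show ?case
    using laplacian_kernel_edge[OF assms]
    by (simp add: Suc matrix_vector_mult_add_rdistrib flip: scaleR_matrix_vector_assoc)
qed

lemma transpose_uga_residual: "transpose (R i) = R i"
  by (simp add: uga_residual transpose_diff transpose_laplacian transpose_uga)

lemma uga_residual_form_bound:
  assumes eig: "sorted_eigenvalues (laplacian E w) lam"
    and zero: "\<forall>j\<in>{1..k}. lam j = 0" and k: "k < CARD('n)"
    and op: "op_norm (R i) \<le> c * lam (k + 1)" and c: "0 \<le> c"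
  shows "\<bar>x \<bullet> (R i *v x)\<bar> \<le> c * (x \<bullet> (laplacian E w *v x))"
proof -
  let ?L = "laplacian E w"
  define K where "K = {y. ?L *v y = 0}"
  have K: "subspace K"
    by (auto simp: K_def subspace_def matrix_vector_right_distrib matrix_vector_mult_scaleR)
  obtain y z where "y \<in> span K" and z: "\<And>v. v \<in> span K \<Longrightarrow> orthogonal z v" and xyz: "x = y + z"
    using orthogonal_subspace_decomp_exists by metis
  then have y: "?L *v y = 0" using K by (simp add: span_eq_iff[THEN iffD2] K_def)
  have "orthogonal z v" if "?L *v v = 0" for v
    using z that by (simp add: K_def span_base)
  note gap = laplacian_spectral_gap[OF eig zero k this]
  have Ry: "R i *v y = 0"
    using y uga_kernel[OF y] by (simp add: uga_residual matrix_vector_mult_diff_rdistrib)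
  \<comment> \<open>The cross term \<open>y \<bullet> (A *v z)\<close> equals
    \<open>(A *v y) \<bullet> z = 0\<close>. Applied to both the residual and the Laplacian, this
    reduces the claim to the component \<open>z\<close> orthogonal to the kernel.\<close>
  have form: "x \<bullet> (A *v x) = z \<bullet> (A *v z)" if "transpose A = A" "A *v y = 0" for A
    using that symmetric_matrix_inner[OF that(1), of y z]
    by (simp add: xyz matrix_vector_right_distrib inner_add_left)
  have "\<bar>x \<bullet> (R i *v x)\<bar> = \<bar>z \<bullet> (R i *v z)\<bar>"
    using form[OF transpose_uga_residual Ry] by simp
  also have "\<dots> \<le> norm z * norm (R i *v z)" by (rule Cauchy_Schwarz_ineq2)
  also have "\<dots> \<le> norm z * (op_norm (R i) * norm z)"
    unfolding op_norm_def by (intro mult_left_mono onorm matrix_vector_mul_bounded_linear) auto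
  also have "\<dots> = op_norm (R i) * (z \<bullet> z)"
    by (simp add: dot_square_norm power2_eq_square)
  also have "\<dots> \<le> (c * lam (k + 1)) * (z \<bullet> z)"
    using op by (intro mult_right_mono) auto
  also have "\<dots> \<le> c * (z \<bullet> (?L *v z))"
    using mult_left_mono[OF gap c] by (simp add: mult.assoc)
  also have "z \<bullet> (?L *v z) = x \<bullet> (?L *v x)"
    using form[OF transpose_laplacian y] by simp
  finally show ?thesis .
qed

end

end

section \<open>From residual decay to the spectral approximation\<close>

theorem theorem3p13:
  fixes E :: "('n::finite \<times> 'n) set"
    and w :: "'n \<times> 'n \<Rightarrow> real"
    and LH R :: "nat \<Rightarrow> real^'n^'n"
    and lam :: "nat \<Rightarrow> real"
    and n k i :: nat
    and \<epsilon> c\<^sub>1 c\<^sub>2 C :: real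
  assumes graph: "weighted_graph E w"
    and n_def: "n = CARD('n)"
    and eigenvalues: "sorted_eigenvalues (laplacian E w) lam"
    and k_range: "1 \<le> k" "k < n"
    and zero_eigenvalues: "\<forall>j\<in>{1..k}. lam j = 0"
    and pos_eigenvalue: "0 < lam (k + 1)"
    and eps: "0 < \<epsilon>" "\<epsilon> < 1"
    and run: "uga_run E w LH R"
    and constants: "0 < c\<^sub>1" "0 < c\<^sub>2"
    and trace_bound: "trace (laplacian E w) / lam (k + 1) \<le> c\<^sub>2 * sqrt (real n * (real n - real k))"
    and iterations: "real i \<ge> real n / \<epsilon>\<^sup>2"
    and residual_bound:
      "(op_norm (R (i + 1)))\<^sup>2 \<le> c\<^sub>1 / (real n - real k) * (frob_norm (R (i + 1)))\<^sup>2"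
    and C_def: "C = sqrt c\<^sub>1 * c\<^sub>2"
    and C_eps: "C * \<epsilon> < 1"
  shows "(1 - C * \<epsilon>) *\<^sub>R laplacian E w \<preceq> LH (i + 1) \<and>
         LH (i + 1) \<preceq> (1 + C * \<epsilon>) *\<^sub>R laplacian E w"
proof -
  let ?L = "laplacian E w"
  let ?T = "trace ?L"
  have n: "0 < real n" "0 < real n - real k" using k_range by auto
  have r: "(norm (R (i + 1)))\<^sup>2 \<le> \<epsilon>\<^sup>2 * ?T\<^sup>2 / n"
  proof -
    have "(norm (R (i + 1)))\<^sup>2 \<le> ?T\<^sup>2 / (real (i + 1) + 1)"
      by (rule uga_residual_bound[OF graph run])
    \<comment> \<open>At index \<open>i + 1\<close> the denominator is \<open>i + 2\<close>, which
      exceeds \<open>i\<close> and hence \<open>n / \<epsilon>^2\<close>.\<close>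
    also have "\<dots> \<le> ?T\<^sup>2 / (real n / \<epsilon>\<^sup>2)"
      using iterations n eps by (intro divide_left_mono) auto
    finally show ?thesis by (simp add: mult.commute)
  qed
  have "?T \<le> c\<^sub>2 * sqrt (real n * (real n - real k)) * lam (k + 1)"
    using trace_bound pos_eigenvalue by (simp add: field_simps)
  then have "?T\<^sup>2 \<le> (c\<^sub>2 * sqrt (real n * (real n - real k)) * lam (k + 1))\<^sup>2"
    using uga_trace_pos[OF graph run] by (intro power_mono) auto
  then have T: "?T\<^sup>2 \<le> c\<^sub>2\<^sup>2 * (real n * (real n - real k)) * (lam (k + 1))\<^sup>2"
    using n by (simp add: power_mult_distrib)
  have "(op_norm (R (i + 1)))\<^sup>2 \<le> c\<^sub>1 / (real n - real k) * (norm (R (i + 1)))\<^sup>2"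
    by (rule residual_bound[unfolded frob_norm_eq_norm])
  also have "\<dots> \<le> c\<^sub>1 / (real n - real k) * (\<epsilon>\<^sup>2 * ?T\<^sup>2 / n)"
    using r n constants by (intro mult_left_mono) auto
  also have "\<dots> \<le> c\<^sub>1 / (real n - real k) *
      (\<epsilon>\<^sup>2 * (c\<^sub>2\<^sup>2 * (real n * (real n - real k)) * (lam (k + 1))\<^sup>2) / n)"
    using T n constants by (intro mult_left_mono divide_right_mono) auto
  \<comment> \<open>The factors \<open>n\<close> and \<open>n - k\<close> cancel exactly; what
    remains of the constants is \<open>c\<^sub>1 * c\<^sub>2^2 = C^2\<close>.\<close>
  also have "\<dots> = (C * \<epsilon> * lam (k + 1))\<^sup>2"
    using n constants by (simp add: C_def power_mult_distrib)
  finally have op: "op_norm (R (i + 1)) \<le> C * \<epsilon> * lam (k + 1)"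
    by (rule power2_le_imp_le) (use constants eps pos_eigenvalue in \<open>simp add: C_def\<close>)
  have "0 \<le> C * \<epsilon>" using constants eps by (simp add: C_def)
  then have bound: "\<bar>x \<bullet> (R (i + 1) *v x)\<bar> \<le> C * \<epsilon> * (x \<bullet> (?L *v x))" for x
    using uga_residual_form_bound[OF graph run eigenvalues zero_eigenvalues _ op] k_range n_def
    by simp
  \<comment> \<open>Both Loewner differences are \<open>C * \<epsilon>\<close> times the Laplacian
    minus or plus the residual, so the two sides of the absolute value in \<open>bound\<close> give
    the two inequalities.\<close>
  have "LH (i + 1) - (1 - C * \<epsilon>) *\<^sub>R ?L = (C * \<epsilon>) *\<^sub>R ?L - R (i + 1)"
    by (simp add: uga_residual[OF graph run] algebra_simps)
  moreover have "(1 + C * \<epsilon>) *\<^sub>R ?L - LH (i + 1) = (C * \<epsilon>) *\<^sub>R ?L + R (i + 1)"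
    by (simp add: uga_residual[OF graph run] algebra_simps)
  moreover have "transpose ((C * \<epsilon>) *\<^sub>R ?L) = (C * \<epsilon>) *\<^sub>R ?L"
    by (simp only: transpose_scalar transpose_laplacian)
  moreover have "x \<bullet> (((C * \<epsilon>) *\<^sub>R ?L) *v x) = C * \<epsilon> * (x \<bullet> (?L *v x))" for x
    by (simp only: inner_scaleR_right flip: scaleR_matrix_vector_assoc)
  ultimately show ?thesis
    using bound transpose_uga_residual[OF graph run, of "i + 1"]
    by (simp only: loewner_le_def psd_def transpose_add transpose_diff inner_add_right
        inner_diff_right matrix_vector_mult_add_rdistrib matrix_vector_mult_diff_rdistrib)
      (auto simp: abs_le_iff simp flip: diff_le_eq)
qed

end
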